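(* Let $n, s, m, i, k$ be positive integers with $s$ even, $n = s(2m+1)$, $2m+1-i = k$ and $1 \le i \le k+1$. Then the power of cycle graph $C_n^k$ is total colorable with $2k+1$ colors.
   Context: All graphs are finite, simple and undirected. A total coloring of a graph $G$ is a map $f: V(G)\cup E(G)\to C$ ($C$ a set of colors) such that adjacent vertices receive different colors, edges sharing an endpoint receive different colors, and every edge receives a color different from those of its two endpoints. A graph is total colorable with $q$ colors if it has a total coloring with $|C| = q$. For integers $n,k$ with $1\le k<\lfloor n/2\rfloor$, the power of cycle graph $C_n^k$ has vertex set $\{v_0,\dots,v_{n-1}\}$ and edges $v_j v_{(j+t) \bmod n}$ for all $0\le j\le n-1$ and $1\le t\le k$. It is the Cayley graph of $\mathbb{Z}_n$ with connection set $\{\pm 1,\dots,\pm k\}$. *)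

theory Defs imports Main
begin

definition simple_graph :: "'a set \<Rightarrow> 'a set set \<Rightarrow> bool" where
  "simple_graph V E \<longleftrightarrow> finite V \<and> (\<forall>e\<in>E. e \<subseteq> V \<and> card e = 2)"

text \<open>A total coloring acts on the disjoint sum of vertices (\<open>Inl\<close>) and edges (\<open>Inr\<close>).
  Values of \<open>f\<close> outside \<open>V <+> E\<close> are irrelevant.\<close>

definition total_coloring ::
  "'a set \<Rightarrow> 'a set set \<Rightarrow> 'c set \<Rightarrow> ('a + 'a set \<Rightarrow> 'c) \<Rightarrow> bool" where
  "total_coloring V E C f \<longleftrightarrow>
     f ` (V <+> E) \<subseteq> C \<and>
     (\<forall>u\<in>V. \<forall>v\<in>V. {u, v} \<in> E \<longrightarrow> f (Inl u) \<noteq> f (Inl v)) \<and>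
     (\<forall>e\<in>E. \<forall>e'\<in>E. e \<noteq> e' \<and> e \<inter> e' \<noteq> {} \<longrightarrow> f (Inr e) \<noteq> f (Inr e')) \<and>
     (\<forall>e\<in>E. \<forall>v\<in>e. f (Inr e) \<noteq> f (Inl v))"

text \<open>Colors are taken to be natural numbers; as only the number of available colors matters,
  this loses no generality.\<close>

definition total_colorable :: "'a set \<Rightarrow> 'a set set \<Rightarrow> nat \<Rightarrow> bool" where
  "total_colorable V E q \<longleftrightarrow>
     (\<exists>(C :: nat set) f. finite C \<and> card C = q \<and> total_coloring V E C f)"

text \<open>The power of cycle \<open>C\<^sub>n\<^sup>k\<close>, with vertex \<open>v\<^sub>j\<close> represented by \<open>j\<close>. It is the intended graph
  for \<open>1 \<le> k < \<lfloor>n/2\<rfloor>\<close>; for larger \<open>k\<close> the set of edges may contain singletons.\<close>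

definition cycle_power_verts :: "nat \<Rightarrow> nat set" where
  "cycle_power_verts n = {0..<n}"

definition cycle_power_edges :: "nat \<Rightarrow> nat \<Rightarrow> nat set set" where
  "cycle_power_edges n k = {{j, (j + t) mod n} | j t. j < n \<and> 1 \<le> t \<and> t \<le> k}"

lemma simple_graph_cycle_power:
  assumes "k < n div 2"
  shows "simple_graph (cycle_power_verts n) (cycle_power_edges n k)"
proof -
  have "(j + t) mod n \<noteq> j" if "j < n" "1 \<le> t" "t \<le> k" for j t
  proof (cases "j + t < n")
    case False
    then have "(j + t) mod n = j + t - n"
      using that assms by (simp add: mod_if)
    then show ?thesis using that assms False by linarith
  qed (use that in simp)
  then show ?thesis
    unfolding simple_graph_def cycle_power_verts_def cycle_power_edges_def
    by (fastforce simp: card_2_iff)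
qed

text \<open>The parameters considered satisfy the standing assumption on \<open>n\<close> and \<open>k\<close>.\<close>

lemma cycle_power_parameters:
  fixes n s m i k :: nat
  assumes "s > 0" "even s" "i > 0" "n = s * (2 * m + 1)" "2 * m + 1 - i = k"
  shows "k < n div 2"
proof -
  obtain r where "s = 2 * r" "r > 0" using assms by (auto elim!: evenE)
  then have "n div 2 = r * (2 * m + 1)" using assms by simp
  also have "\<dots> \<ge> 2 * m + 1" using mult_le_mono1[of 1 r "2 * m + 1"] \<open>r > 0\<close> by simp
  finally show ?thesis using assms by linarith
qed

end

theory Submission imports Defs
begin

text \<open>Let \<open>p = 2m + 1\<close>, so \<open>k < p \<le> 2k + 1\<close>. Colour vertex \<open>v\<close> with \<open>2v mod p\<close>. For a set of
  distances containing exactly one element of each pair \<open>{t, p - t}\<close>, colouring the edge \<open>ab\<close> with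
  \<open>(a + b) mod p\<close> completes this to a total colouring with \<open>p\<close> colours. Since \<open>p\<close> is odd, whenever
  both \<open>t\<close> and \<open>p - t\<close> are at most \<open>k\<close> we can select the even one. The \<open>k - m\<close> distances left over
  are then odd, and as \<open>n\<close> is even each of them spans a bipartite 2-regular graph, which needs two of
  the \<open>2(k - m)\<close> remaining colours.\<close>

text \<open>A total colouring is described here by the colours \<open>L v d\<close> seen at a vertex \<open>v\<close>: that of the edge
  to \<open>v + d\<close> for \<open>d \<noteq> 0\<close>, and that of \<open>v\<close> itself for \<open>d = 0\<close>.\<close>

lemma inj_on_cycle_power_arcs:
  fixes n k :: nat
  assumes "2 * k < n"
  shows "inj_on (\<lambda>(j, t). {j, (j + t) mod n}) ({..<n} \<times> {1..k})"
proof -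
  have "j = j' \<and> t = t'"
    if b: "j < n" "j' < n" "1 \<le> t" "t \<le> k" "1 \<le> t'" "t' \<le> k"
      and e: "{j, (j + t) mod n} = {j', (j' + t') mod n}" for j j' t t'
  proof -
    have m: "(x + y) mod n = (if x + y < n then x + y else x + y - n)"
      if "x < n" "y \<le> k" for x y
      using that assms by (simp add: mod_if)
    from e consider "j = j'" "(j + t) mod n = (j' + t') mod n"
      | "j = (j' + t') mod n" "j' = (j + t) mod n"
      by (auto simp: doubleton_eq_iff)
    then show ?thesis
    proof cases
      case 1
      then show ?thesis
        using b assms m[of j t] m[of j t'] by (simp split: if_splits)
    next
      case 2
      have "j' = j + t \<or> j' + n = j + t"
        using 2(2) m[OF b(1,4)] by (simp split: if_splits)
      moreover have "j = j' + t' \<or> j + n = j' + t'"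
        using 2(1) m[OF b(2,6)] by (simp split: if_splits)
      \<comment> \<open>Adding the two alternatives makes \<open>t + t'\<close> one of
        \<open>0\<close>, \<open>n\<close>, \<open>2 * n\<close>, although
        \<open>2 \<le> t + t'\<close> and \<open>t + t' \<le> 2 * k < n\<close>.\<close>
      ultimately have False using b assms by linarith
      then show ?thesis ..
    qed
  qed
  then show ?thesis by (force simp: inj_on_def)
qed

lemma total_colorable_cycle_power_local:
  fixes n k q :: nat and L :: "int \<Rightarrow> int \<Rightarrow> nat"
  assumes "2 * k < n"
    and range: "\<And>v d. \<bar>d\<bar> \<le> int k \<Longrightarrow> L v d < q"
    and inj: "\<And>v. inj_on (L v) {- int k..int k}"
    and sym: "\<And>v d. 1 \<le> d \<Longrightarrow> d \<le> int k \<Longrightarrow> L ((v + d) mod int n) (- d) = L v d"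
    and vert: "\<And>v d. 1 \<le> d \<Longrightarrow> d \<le> int k \<Longrightarrow> L ((v + d) mod int n) 0 \<noteq> L v 0"
  shows "total_colorable (cycle_power_verts n) (cycle_power_edges n k) q"
proof -
  let ?E = "cycle_power_edges n k"
  define A where "A = {..<n} \<times> {1..k}"
  define ends where "ends = (\<lambda>(j, t). {j, (j + t) mod n})"
  \<comment> \<open>Each edge comes from exactly one forward arc \<open>(j, t)\<close>, so its
    colour can be read off at the tail \<open>j\<close>.\<close>
  define col where "col e = (case inv_into A ends e of (j, t) \<Rightarrow> L (int j) (int t))" for e
  define f where "f = case_sum (\<lambda>v. L (int v) 0) col"
  have col: "col {j, (j + t) mod n} = L (int j) (int t)" if "j < n" "1 \<le> t" "t \<le> k" for j t
  proof -
    have "inv_into A ends (ends (j, t)) = (j, t)"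
      using inj_on_cycle_power_arcs[OF \<open>2 * k < n\<close>] that
      by (intro inv_into_f_f) (auto simp: A_def ends_def)
    then show ?thesis by (simp add: col_def ends_def)
  qed
  have edgeE: "\<exists>j t. e = {j, (j + t) mod n} \<and> j < n \<and> 1 \<le> t \<and> t \<le> k" if "e \<in> ?E" for e
    using that by (auto simp: cycle_power_edges_def)
  \<comment> \<open>Seen from either end, an edge is a signed offset: \<open>t\<close> at the tail
    and \<open>- t\<close> at the head, where \<open>sym\<close> shows that the same colour is read.
    Injectivity of \<open>L v\<close> then settles all conflicts at \<open>v\<close>, those with
    \<open>v\<close> itself being the case of offset \<open>0\<close>.\<close>
  have incident: "\<exists>d. 1 \<le> \<bar>d\<bar> \<and> \<bar>d\<bar> \<le> int k \<and> e = {v, nat ((int v + d) mod int n)}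
      \<and> col e = L (int v) d" if "e \<in> ?E" "v \<in> e" for e v
  proof -
    obtain j t where e: "e = {j, (j + t) mod n}" and jt: "j < n" "1 \<le> t" "t \<le> k"
      using edgeE[OF \<open>e \<in> ?E\<close>] by blast
    from \<open>v \<in> e\<close> e consider "v = j" | "v = (j + t) mod n" by blast
    then show ?thesis
    proof cases
      case 1
      have "nat ((int v + int t) mod int n) = (v + t) mod n"
        by (metis nat_int of_nat_add of_nat_mod)
      then show ?thesis
        using 1 e jt col[OF jt] by (intro exI[of _ "int t"]) auto
    next
      case 2
      have v: "int v = (int j + int t) mod int n"
        by (simp add: 2 of_nat_mod)
      then have "(int v + - int t) mod int n = int j"
        using jt by (simp add: mod_simps)
      moreover have "col e = L (int v) (- int t)"
        using sym[of "int t" "int j"] jt v col[OF jt] e by simp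
      ultimately show ?thesis
        using 2 e jt by (intro exI[of _ "- int t"]) auto
    qed
  qed
  have "f (Inl u) \<noteq> f (Inl v)" if "{u, v} \<in> ?E" for u v
  proof -
    obtain j t where e: "{u, v} = {j, (j + t) mod n}" and jt: "j < n" "1 \<le> t" "t \<le> k"
      using edgeE[OF \<open>{u, v} \<in> ?E\<close>] by blast
    have "L (int ((j + t) mod n)) 0 \<noteq> L (int j) 0"
      using vert[of "int t" "int j"] jt by (simp add: of_nat_mod)
    with e show ?thesis by (auto simp: f_def doubleton_eq_iff)
  qed
  moreover have "f (Inr e) \<noteq> f (Inr e')"
    if "e \<in> ?E" "e' \<in> ?E" "e \<noteq> e'" "e \<inter> e' \<noteq> {}" for e e'
  proof -
    obtain v where v: "v \<in> e" "v \<in> e'" using \<open>e \<inter> e' \<noteq> {}\<close> by blast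
    obtain d where d: "\<bar>d\<bar> \<le> int k" "e = {v, nat ((int v + d) mod int n)}" "col e = L (int v) d"
      using incident[OF \<open>e \<in> ?E\<close> v(1)] by blast
    obtain d' where d': "\<bar>d'\<bar> \<le> int k" "e' = {v, nat ((int v + d') mod int n)}"
        "col e' = L (int v) d'"
      using incident[OF \<open>e' \<in> ?E\<close> v(2)] by blast
    have "d \<noteq> d'" using d d' \<open>e \<noteq> e'\<close> by auto
    then have "L (int v) d \<noteq> L (int v) d'"
      using inj_onD[OF inj, of "int v" d d'] d(1) d'(1) by (auto simp: abs_le_iff)
    then show ?thesis using d d' by (simp add: f_def)
  qed
  moreover have "f (Inr e) \<noteq> f (Inl v)" if "e \<in> ?E" "v \<in> e" for e v
  proof -
    obtain d where d: "1 \<le> \<bar>d\<bar>" "\<bar>d\<bar> \<le> int k" "col e = L (int v) d"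
      using incident[OF \<open>e \<in> ?E\<close> \<open>v \<in> e\<close>] by blast
    then have "L (int v) d \<noteq> L (int v) 0"
      using inj_onD[OF inj, of "int v" d 0] by (auto simp: abs_le_iff)
    then show ?thesis using d by (simp add: f_def)
  qed
  moreover have "f ` (cycle_power_verts n <+> ?E) \<subseteq> {..<q}"
    using col range by (auto simp: f_def dest!: edgeE)
  ultimately have "total_coloring (cycle_power_verts n) ?E {..<q} f"
    unfolding total_coloring_def by blast
  then show ?thesis
    unfolding total_colorable_def by (metis card_lessThan finite_lessThan)
qed

text \<open>\<open>2 * v + d\<close> is the sum of the ends \<open>v\<close> and
  \<open>v + d\<close>. In the second branch, halving numbers the odd distances from
  \<open>p - k\<close> to \<open>k\<close> consecutively from 0, and each gets two colours, chosen
  by the parity of the tail of the arc. For odd \<open>d < 0\<close> the tail is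
  \<open>v + d\<close>, of the same parity as \<open>v - 1\<close>.\<close>

definition local_color :: "int \<Rightarrow> int \<Rightarrow> int \<Rightarrow> int \<Rightarrow> int" where
  "local_color p k v d =
     (if even d \<or> \<bar>d\<bar> < p - k then (2 * v + d) mod p
      else p + 2 * ((\<bar>d\<bar> - (p - k)) div 2) + (if d < 0 then v - 1 else v) mod 2)"

lemma local_color_bounds:
  assumes "odd p" "k < p" "p \<le> 2 * k + 1" "\<bar>d\<bar> \<le> k"
  shows "0 \<le> local_color p k v d \<and> local_color p k v d < 2 * k + 1"
proof (cases "even d \<or> \<bar>d\<bar> < p - k")
  case True
  then have "local_color p k v d = (2 * v + d) mod p" by (auto simp: local_color_def)
  moreover have "0 < p" using assms by linarith
  ultimately show ?thesis
    using assms pos_mod_bound[of p "2 * v + d"] pos_mod_sign[of p "2 * v + d"] by linarith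
next
  case False
  define x where "x = (if d < 0 then v - 1 else v) mod 2"
  have "0 \<le> x" "x < 2" by (auto simp: x_def)
  moreover obtain r where r: "p = 2 * r + 1" using \<open>odd p\<close> by (elim oddE)
  moreover define y where "y = \<bar>d\<bar> - (p - k)"
  \<comment> \<open>The upper bound is \<open>k - (p - k)\<close>. It is odd, so halving rounds down
    to \<open>k - r - 1\<close> and the largest colour is
    \<open>p + 2 * (k - r - 1) + 1 = 2 * k\<close>.\<close>
  moreover have "0 \<le> y" "y \<le> 2 * (k - r) - 1" using False assms r by (auto simp: y_def)
  then have "0 \<le> y div 2" "y div 2 \<le> k - r - 1" by presburger+
  moreover have "local_color p k v d = p + 2 * (y div 2) + x"
    using False by (simp add: local_color_def x_def y_def)
  ultimately show ?thesis using assms(2) r by linarith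
qed

lemma inj_on_local_color:
  assumes "odd p" "k < p" "p \<le> 2 * k + 1"
  shows "inj_on (local_color p k v) {- k..k}"
proof (rule inj_onI)
  fix d d' assume "d \<in> {- k..k}" "d' \<in> {- k..k}"
  then have b: "- k \<le> d" "d \<le> k" "- k \<le> d'" "d' \<le> k" by auto
  assume eq: "local_color p k v d = local_color p k v d'"
  let ?D = "\<lambda>d. even d \<or> \<bar>d\<bar> < p - k"
  \<comment> \<open>The two branches use disjoint colours, so a common colour puts \<open>d\<close>
    and \<open>d'\<close> in the same branch.\<close>
  have low: "local_color p k v d < p \<longleftrightarrow> ?D d" for d
  proof (cases "?D d")
    case False
    then have "0 \<le> (\<bar>d\<bar> - (p - k)) div 2" by (auto simp: pos_imp_zdiv_nonneg_iff)
    moreover have "0 \<le> (if d < 0 then v - 1 else v) mod 2" by simp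
    moreover have "local_color p k v d =
        p + 2 * ((\<bar>d\<bar> - (p - k)) div 2) + (if d < 0 then v - 1 else v) mod 2"
      using False by (simp only: local_color_def if_False)
    ultimately show ?thesis using False by linarith
  qed (use assms b in \<open>auto simp: local_color_def\<close>)
  show "d = d'"
  proof (cases "?D d")
    case True
    then have "?D d'" using low eq by metis
    then have "(2 * v + d) mod p = (2 * v + d') mod p"
      using True eq by (simp add: local_color_def)
    then have "p dvd d - d'" by (simp add: mod_eq_dvd_iff)
    then obtain c where c: "d - d' = p * c" by blast
    have "\<bar>p * c\<bar> < p * 2" using b c assms by linarith
    then have "\<bar>c\<bar> < 2" using assms b by (auto simp: abs_mult)
    \<comment> \<open>If \<open>d\<close> and \<open>d'\<close> differ by \<open>p\<close>, both
      have absolute value at least \<open>p - k\<close>. Then \<open>?D\<close> makes both even,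
      contradicting that \<open>p\<close> is odd.\<close>
    then consider "c = 0" | "c = 1" | "c = - 1" by linarith
    then show ?thesis
    proof cases
      case 2
      then have "d = d' + p" using c by simp
      then show ?thesis using True \<open>?D d'\<close> \<open>odd p\<close> b assms by auto
    next
      case 3
      then have "d' = d + p" using c by simp
      then show ?thesis using True \<open>?D d'\<close> \<open>odd p\<close> b assms by auto
    qed (use c in simp)
  next
    case False
    then have F': "\<not> ?D d'" using low eq by metis
    define x where "x d = (if d < 0 then v - 1 else v) mod 2" for d :: int
    have x: "0 \<le> x d" "x d < 2" for d by (auto simp: x_def)
    have e: "2 * ((\<bar>d\<bar> - (p - k)) div 2) + x d = 2 * ((\<bar>d'\<bar> - (p - k)) div 2) + x d'"
      using eq False F' by (simp add: local_color_def x_def)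
    then have "x d = x d'" "(\<bar>d\<bar> - (p - k)) div 2 = (\<bar>d'\<bar> - (p - k)) div 2"
      using x[of d] x[of d'] by presburger+
    moreover have "\<bar>d\<bar> mod 2 = 1" "\<bar>d'\<bar> mod 2 = 1" using False F' by presburger+
    \<comment> \<open>Halving after a shift is injective on odd numbers; the sign of
      \<open>d\<close> is then recovered from the parity digit \<open>x d\<close>.\<close>
    ultimately have "\<bar>d\<bar> = \<bar>d'\<bar>" by presburger
    moreover have "(v - 1) mod 2 \<noteq> v mod 2" by presburger
    ultimately show ?thesis
      using \<open>x d = x d'\<close> by (auto simp: x_def abs_if split: if_splits)
  qed
qed

text \<open>The sum of the ends and the tail are the same from both sides. Reduction modulo
  \<open>n\<close> respects residues modulo \<open>p\<close> and parity.\<close>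

lemma local_color_opposite:
  assumes "p dvd n" "even n" "0 < d"
  shows "local_color p k ((v + d) mod n) (- d) = local_color p k v d"
proof -
  define w where "w = (v + d) mod n"
  have "n dvd w - (v + d)" by (simp add: w_def mod_eq_dvd_iff [symmetric])
  then have pw: "p dvd w - (v + d)" and "even (w - (v + d))"
    using assms dvd_trans by blast+
  have "p dvd 2 * (w - (v + d))" using pw by (rule dvd_mult)
  then have "p dvd 2 * w + - d - (2 * v + d)" by (simp add: algebra_simps)
  then have "(2 * w + - d) mod p = (2 * v + d) mod p" by (simp only: mod_eq_dvd_iff)
  moreover have "(w - 1) mod 2 = v mod 2" if "odd d"
    using that \<open>even (w - (v + d))\<close> by presburger
  ultimately show ?thesis
    using \<open>0 < d\<close> by (simp add: local_color_def flip: w_def)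
qed

text \<open>The two colours differ by \<open>2 * d\<close> modulo \<open>p\<close>, which is nonzero
  as \<open>p\<close> is odd and \<open>0 < d < p\<close>.\<close>

lemma local_color_adjacent:
  assumes "p dvd n" "odd p" "0 < d" "d < p"
  shows "local_color p k ((v + d) mod n) 0 \<noteq> local_color p k v 0"
proof
  define w where "w = (v + d) mod n"
  assume "local_color p k ((v + d) mod n) 0 = local_color p k v 0"
  then have "p dvd 2 * w - 2 * v" by (simp add: local_color_def mod_eq_dvd_iff flip: w_def)
  moreover have "n dvd w - (v + d)" by (simp add: w_def mod_eq_dvd_iff [symmetric])
  then have "p dvd 2 * (w - (v + d))" using assms dvd_trans by (metis dvd_mult)
  ultimately have "p dvd (2 * w - 2 * v) - 2 * (w - (v + d))" by (rule dvd_diff)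
  then have "p dvd 2 * d" by (simp add: algebra_simps)
  then have "p dvd d" using \<open>odd p\<close> by (simp add: coprime_dvd_mult_right_iff)
  then show False using assms by (auto dest: zdvd_imp_le)
qed

theorem theorem2p2:
  fixes n s m i k :: nat
  assumes "n > 0" and "s > 0" and "m > 0" and "i > 0" and "k > 0"
    and "even s"
    and "n = s * (2 * m + 1)"
    and "2 * m + 1 - i = k"
    and "1 \<le> i" and "i \<le> k + 1"
  shows "total_colorable (cycle_power_verts n) (cycle_power_edges n k) (2 * k + 1)"
proof -
  define p where "p = int (2 * m + 1)"
  \<comment> \<open>Since \<open>k > 0\<close>, the subtraction is not truncated and
    \<open>p = k + i\<close>; the bounds on \<open>p\<close> are those on \<open>i\<close>.\<close>
  have p: "odd p" "int k < p" "p \<le> 2 * int k + 1"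
    using assms by (auto simp: p_def)
  have n: "p dvd int n" "even (int n)"
    using assms(6,7) by (simp_all only: p_def int_dvd_int_iff even_of_nat dvd_triv_right even_mult_iff simp_thms)
  have "2 * k < n"
    using cycle_power_parameters[of s i n m k] assms by linarith
  then show ?thesis
  proof (rule total_colorable_cycle_power_local[where L = "\<lambda>v d. nat (local_color p (int k) v d)"])
    fix v d :: int
    show "nat (local_color p (int k) v d) < 2 * k + 1" if "\<bar>d\<bar> \<le> int k"
      using local_color_bounds[OF p that, of v] by auto
    show "inj_on (\<lambda>d. nat (local_color p (int k) v d)) {- int k..int k}"
      using inj_on_local_color[OF p, of v] local_color_bounds[OF p, of _ v]
      by (fastforce simp: inj_on_def eq_nat_nat_iff abs_le_iff)
    assume d: "1 \<le> d" "d \<le> int k"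
    show "nat (local_color p (int k) ((v + d) mod int n) (- d)) = nat (local_color p (int k) v d)"
      using local_color_opposite[OF n] d by simp
    have "local_color p (int k) ((v + d) mod int n) 0 \<noteq> local_color p (int k) v 0"
      using local_color_adjacent[OF n(1) p(1)] d p by auto
    then show "nat (local_color p (int k) ((v + d) mod int n) 0) \<noteq> nat (local_color p (int k) v 0)"
      using local_color_bounds[OF p, of 0] by (simp add: eq_nat_nat_iff)
  qed
qed

end
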